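(* Let $s\ge 2$ and $n_1,\dots,n_s\ge 2$ be integers, and let $G=KS(n_1,n_2,\ldots,n_s)$ be the clique-star on these cliques. Then $q(G)=3$.
   Context: All graphs are finite and simple. For a graph $G$ with vertex set $\{1,\dots,n\}$, $\mathcal{S}(G)$ is the set of real symmetric $n\times n$ matrices $A=[a_{ij}]$ such that for $i\neq j$, $a_{ij}\neq 0$ if and only if $ij$ is an edge of $G$ (diagonal unrestricted). $q(A)$ is the number of distinct eigenvalues of $A$ and $q(G)=\min\{q(A): A\in\mathcal{S}(G)\}$. For $s\ge 2$ and $n_i\ge 2$, the clique-star $KS(n_1,\dots,n_s)$ is the graph obtained from complete graphs $K_{n_1},\dots,K_{n_s}$ by identifying one vertex from each into a single common vertex (the center), the cliques being otherwise disjoint; i.e. it is built by vertex sums using only one summing vertex. *)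

theory Defs
  imports "Jordan_Normal_Form.Char_Poly" "Graph_Theory.Kuratowski"
begin

text \<open>
  A finite simple graph is a \<open>pair_graph\<close>: its set of arcs is finite, irreflexive and symmetric,
  an edge \<open>ij\<close> being the pair of arcs \<open>(i, j)\<close>, \<open>(j, i)\<close>. Matrices are indexed from \<open>0\<close>, so the
  vertex set \<open>{1, \<dots>, n}\<close> becomes \<open>{0..<n}\<close>; \<open>sym_matrices\<close> is meaningful only for graphs with
  such a vertex set.
\<close>

definition sym_matrices :: "nat pair_pre_digraph \<Rightarrow> real mat set" where
  "sym_matrices G = {A \<in> carrier_mat (card (pverts G)) (card (pverts G)).
     transpose_mat A = A \<and>
     (\<forall>i < card (pverts G). \<forall>j < card (pverts G).
        i \<noteq> j \<longrightarrow> (A $$ (i, j) \<noteq> 0 \<longleftrightarrow> (i, j) \<in> parcs G))}"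

text \<open>Eigenvalues of a symmetric real matrix are all real, so counting real ones loses nothing.\<close>

definition q_matrix :: "real mat \<Rightarrow> nat" where
  "q_matrix A = card {k. eigenvalue A k}"

definition q_graph :: "nat pair_pre_digraph \<Rightarrow> nat" where
  "q_graph G = (LEAST k. \<exists>A \<in> sym_matrices G. q_matrix A = k)"

text \<open>
  \<open>is_clique_star ns G\<close> says that \<open>G\<close> is a copy of \<open>KS(n\<^sub>1, \<dots>, n\<^sub>s)\<close>, where
  \<open>ns = [n\<^sub>1, \<dots>, n\<^sub>s]\<close>, with the vertices labelled in an arbitrary way: \<open>G\<close> is the union of
  complete graphs \<open>H i\<close> on \<open>ns ! i\<close> vertices, any two of which share exactly the center \<open>c\<close>.
\<close>

definition is_clique_star :: "nat list \<Rightarrow> 'a pair_pre_digraph \<Rightarrow> bool" where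
  "is_clique_star ns G \<longleftrightarrow>
     (\<exists>c (H :: nat \<Rightarrow> 'a pair_pre_digraph).
        (\<forall>i < length ns. complete_digraph (ns ! i) (with_proj (H i)) \<and> c \<in> pverts (H i)) \<and>
        (\<forall>i < length ns. \<forall>j < length ns. i \<noteq> j \<longrightarrow> pverts (H i) \<inter> pverts (H j) = {c}) \<and>
        pverts G = (\<Union>i < length ns. pverts (H i)) \<and>
        parcs G = (\<Union>i < length ns. parcs (H i)))"

lemma q_graph_attained:
  assumes "pair_graph G"
  shows "\<exists>A \<in> sym_matrices G. q_matrix A = q_graph G"
    and "A \<in> sym_matrices G \<Longrightarrow> q_graph G \<le> q_matrix A"
proof -
  interpret pair_graph G by fact
  define n where "n = card (pverts G)"
  define A where "A = mat n n (\<lambda>(i, j). if (i, j) \<in> parcs G then 1 else 0 :: real)"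
  have sym: "(i, j) \<in> parcs G \<longleftrightarrow> (j, i) \<in> parcs G" for i j
    using arcs_symmetric by blast
  have "A \<in> sym_matrices G"
    by (auto simp: sym_matrices_def A_def n_def sym)
  then have "\<exists>k. \<exists>A \<in> sym_matrices G. q_matrix A = k" by blast
  then show "\<exists>A \<in> sym_matrices G. q_matrix A = q_graph G"
    unfolding q_graph_def by (rule LeastI_ex)
  show "A \<in> sym_matrices G \<Longrightarrow> q_graph G \<le> q_matrix A" for A
    unfolding q_graph_def by (rule Least_le) blast
qed

lemma is_clique_star_pair_graph:
  assumes "is_clique_star ns G"
  shows "pair_graph G"
proof -
  obtain H c where H: "\<forall>i < length ns. complete_digraph (ns ! i) (with_proj (H i)) \<and> c \<in> pverts (H i)"
    and V: "pverts G = (\<Union>i < length ns. pverts (H i))"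
    and E: "parcs G = (\<Union>i < length ns. parcs (H i))"
    using assms unfolding is_clique_star_def by (elim exE conjE)
  have fin: "finite (pverts (H i))"
    and arcs: "parcs (H i) = {(u, v). (u, v) \<in> pverts (H i) \<times> pverts (H i) \<and> u \<noteq> v}"
    if "i < length ns" for i
    using H[rule_format, OF that] unfolding complete_digraph_pair_def by simp_all
  have finV: "finite (pverts G)" using fin by (auto simp: V)
  have sub: "parcs G \<subseteq> pverts G \<times> pverts G" by (auto simp: V E arcs)
  show ?thesis
  proof
    show "finite (parcs G)" using finV sub by (meson finite_SigmaI finite_subset)
    show "symmetric (with_proj G)"
      by (auto simp: symmetric_def arcs_ends_def arc_to_ends_def E arcs intro!: symI)
  qed (use finV in \<open>auto simp: V E arcs\<close>)
qed

lemma is_clique_star_exists: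
  assumes "ns \<noteq> []" and pos: "\<forall>k \<in> set ns. k \<ge> 1"
  shows "\<exists>(G :: nat pair_pre_digraph) n. is_clique_star ns G \<and> pverts G = {0..<n}"
proof -
  define off where "off i = (\<Sum>j<i. ns ! j - 1)" for i
  define V where "V i = insert 0 {off i <.. off (Suc i)}" for i
  define H where "H i = \<lparr>pverts = V i, parcs = {(u, v). (u, v) \<in> V i \<times> V i \<and> u \<noteq> v}\<rparr>" for i
  define G where "G = \<lparr>pverts = (\<Union>i < length ns. V i), parcs = (\<Union>i < length ns. parcs (H i))\<rparr>"
  have mono: "off i \<le> off j" if "i \<le> j" for i j
    unfolding off_def using that by (intro sum_mono2) auto
  have card: "card (V i) = ns ! i" "finite (V i)" if "i < length ns" for i
  proof -
    have "Suc (ns ! i - Suc 0) = ns ! i" using pos nth_mem[OF that] by fastforce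
    then show "card (V i) = ns ! i" "finite (V i)" by (simp_all add: V_def off_def)
  qed
  have disj: "V i \<inter> V j = {0}" if "i < j" for i j
    using mono[of "Suc i" j] that by (auto simp: V_def)
  have disj': "V i \<inter> V j = {0}" if "i \<noteq> j" for i j
    using disj[of i j] disj[of j i] that by (metis Int_commute linorder_neqE_nat)
  have un: "m > 0 \<Longrightarrow> (\<Union>i < m. V i) = {0..<Suc (off m)}" for m
  proof (induction m)
    case (Suc m)
    show ?case
    proof (cases "m = 0")
      case True
      then show ?thesis by (auto simp: V_def off_def)
    next
      case False
      then have "(\<Union>i < Suc m. V i) = {0..<Suc (off m)} \<union> V m"
        using Suc.IH by (auto simp: lessThan_Suc)
      also have "\<dots> = {0..<Suc (off (Suc m))}"
        using mono[of m "Suc m"] by (auto simp: V_def)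
      finally show ?thesis .
    qed
  qed simp
  have "is_clique_star ns G"
    unfolding is_clique_star_def
  proof (intro exI conjI allI impI)
    fix i assume i: "i < length ns"
    show "complete_digraph (ns ! i) (with_proj (H i))"
      unfolding complete_digraph_pair_def using card[OF i] by (simp add: H_def)
    show "0 \<in> pverts (H i)" by (simp add: H_def V_def)
  next
    fix i j :: nat assume "i \<noteq> j"
    then show "pverts (H i) \<inter> pverts (H j) = {0}" using disj' by (simp add: H_def)
  qed (simp_all add: G_def H_def)
  moreover have "pverts G = {0..<Suc (off (length ns))}"
    using un assms(1) by (simp add: G_def)
  ultimately show ?thesis by blast
qed

end

theory Submission
  imports Defs "Jordan_Normal_Form.Schur_Decomposition" "Jordan_Normal_Form.Spectral_Radius"
begin

text \<open>
  Lower bound: a real symmetric matrix \<open>A\<close> with at most two eigenvalues \<open>a, b\<close> satisfies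
  \<open>(A - a)(A - b) = 0\<close>. If \<open>x\<close> and \<open>y\<close> are non-central vertices of different cliques, then they
  are not adjacent and the center \<open>c\<close> is their only common neighbour, so the \<open>(x, y)\<close> entry of
  this product is \<open>a\<^sub>x\<^sub>c a\<^sub>c\<^sub>y \<noteq> 0\<close>.

  Upper bound: let \<open>w\<^sub>i = e\<^sub>c + u\<^sub>i\<close>, where \<open>u\<^sub>i\<close> is the unit vector constant on the non-central
  vertices of the \<open>i\<close>-th clique. Then \<open>A = \<Sum>\<^sub>i w\<^sub>i w\<^sub>i\<^sup>T\<close> has the pattern of the clique-star, and its
  nonzero eigenvalues are those of the Gram matrix \<open>I + J\<close> of the \<open>w\<^sub>i\<close>, namely \<open>1\<close> and \<open>1 + s\<close>.
\<close>

section \<open>Symmetric matrices and the reality of their spectrum\<close>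

text \<open>The product \<open>\<bullet>\<close> is bilinear, without conjugation, so one statement
  over a commutative ring serves both the real matrix and its complexification.\<close>

lemma symmetric_mat_scalar_prod:
  fixes A :: "'a :: comm_ring_1 mat"
  assumes A: "A \<in> carrier_mat n n" "transpose_mat A = A"
    and v: "v \<in> carrier_vec n" and w: "w \<in> carrier_vec n"
  shows "(A *\<^sub>v v) \<bullet> w = v \<bullet> (A *\<^sub>v w)"
proof -
  have "(A *\<^sub>v v) \<bullet> w = w \<bullet> (A *\<^sub>v v)"
    using A v w by (intro comm_scalar_prod[of _ n]) auto
  also have "\<dots> = (transpose_mat A *\<^sub>v w) \<bullet> v"
    using A v w by (metis transpose_vec_mult_scalar)
  also have "\<dots> = v \<bullet> (A *\<^sub>v w)"
    using A v w by (simp, intro comm_scalar_prod[of _ n]) auto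
  finally show ?thesis .
qed

text \<open>Since \<open>A\<close> has real entries, \<open>conjugate v\<close> is an eigenvector
  for \<open>cnj k\<close>. Moving the matrix across the product of \<open>v\<close> and
  \<open>conjugate v\<close> gives \<open>k\<close> and \<open>cnj k\<close> times the same nonzero
  number.\<close>

lemma eigenvalue_real_symmetric_imp_real:
  fixes A :: "real mat"
  assumes A: "A \<in> carrier_mat n n" "transpose_mat A = A"
    and k: "eigenvalue (map_mat complex_of_real A) k"
  shows "k \<in> \<real>"
proof -
  let ?M = "map_mat complex_of_real A"
  have M: "?M \<in> carrier_mat n n" "transpose_mat ?M = ?M"
    using A by (auto simp: map_mat_transpose)
  obtain v where v: "v \<in> carrier_vec n" "v \<noteq> 0\<^sub>v n" "?M *\<^sub>v v = k \<cdot>\<^sub>v v"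
    using k A unfolding eigenvalue_def eigenvector_def by auto
  have cv: "conjugate v \<in> carrier_vec n" using v(1) by simp
  have conjM: "?M *\<^sub>v conjugate v = conjugate (?M *\<^sub>v v)"
    using A v(1) by (intro eq_vecI) (auto simp: scalar_prod_def conjugate_complex_def)
  have "k * (v \<bullet> conjugate v) = (?M *\<^sub>v v) \<bullet> conjugate v"
    using v cv by simp
  also have "\<dots> = v \<bullet> (?M *\<^sub>v conjugate v)"
    by (rule symmetric_mat_scalar_prod[OF M v(1) cv])
  also have "\<dots> = cnj k * (v \<bullet> conjugate v)"
    using v cv by (simp add: conjM conjugate_smult_vec conjugate_complex_def)
  finally have "k = cnj k"
    using conjugate_square_eq_0_vec[OF v(1)] v(2) by simp
  then show ?thesis by (simp add: Reals_cnj_iff)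
qed

text \<open>Schur triangularisation over the reals needs the linear factors as input. They are
  obtained over the complex numbers, where every root is an eigenvalue and hence real, and pulled
  back by injectivity of the coefficient embedding.\<close>

lemma char_poly_real_symmetric_splits:
  fixes A :: "real mat"
  assumes A: "A \<in> carrier_mat n n" "transpose_mat A = A"
  shows "\<exists>es. char_poly A = (\<Prod>e\<leftarrow>es. [:- e, 1:])"
proof -
  let ?M = "map_mat complex_of_real A"
  interpret of_real_poly: map_poly_inj_idom_hom complex_of_real ..
  have M: "?M \<in> carrier_mat n n" using A by simp
  obtain as where as: "char_poly ?M = (\<Prod>a\<leftarrow>as. [:- a, 1:])"
    using char_poly_factorized[OF M] by blast
  have real: "complex_of_real (Re a) = a" if "a \<in> set as" for a
  proof -
    have "eigenvalue ?M a"
      using linear_poly_root[OF that] by (simp add: eigenvalue_root_char_poly[OF M] as)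
    then show ?thesis using eigenvalue_real_symmetric_imp_real[OF A] by simp
  qed
  have "map_poly complex_of_real (\<Prod>e\<leftarrow>map Re as. [:- e, 1:]) = (\<Prod>a\<leftarrow>as. [:- a, 1:])"
    using real by (simp add: of_real_poly.hom_prod_list o_def cong: map_cong)
  also have "\<dots> = map_poly complex_of_real (char_poly A)"
    unfolding as[symmetric] by (rule of_real_hom.char_poly_hom[OF A(1)])
  finally show ?thesis by (metis of_real_poly.injectivity)
qed

text \<open>By symmetry the squared length of \<open>A v\<close> is the product of \<open>v\<close>
  with \<open>A (A v)\<close>, which is zero, and the real form is definite.\<close>

lemma symmetric_mat_ker_square:
  fixes A :: "real mat"
  assumes A: "A \<in> carrier_mat n n" "transpose_mat A = A"
    and v: "v \<in> carrier_vec n" and "A *\<^sub>v (A *\<^sub>v v) = 0\<^sub>v n"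
  shows "A *\<^sub>v v = 0\<^sub>v n"
proof -
  have Av: "A *\<^sub>v v \<in> carrier_vec n" using A v by simp
  have "(A *\<^sub>v v) \<bullet> (A *\<^sub>v v) = 0"
    using symmetric_mat_scalar_prod[OF A v Av] assms(4) v by simp
  then show ?thesis using conjugate_square_eq_0_vec[OF Av] by simp
qed

text \<open>
  Triangularise \<open>A = P B P\<^sup>-\<^sup>1\<close>: the factor \<open>B - B\<^sub>m\<^sub>m\<close> sends vectors supported on the first \<open>m + 1\<close>
  coordinates to vectors supported on the first \<open>m\<close>. By induction on the support, some product of
  factors \<open>A - a\<close>, \<open>A - b\<close> kills \<open>P v\<close>, and symmetry removes repeated factors.
\<close>

lemma symmetric_mat_two_eigenvalues:
  fixes A :: "real mat"
  assumes A: "A \<in> carrier_mat n n" "transpose_mat A = A"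
    and ev: "\<And>k. eigenvalue A k \<Longrightarrow> k = a \<or> k = b"
  shows "(A - a \<cdot>\<^sub>m 1\<^sub>m n) * (A - b \<cdot>\<^sub>m 1\<^sub>m n) = 0\<^sub>m n n"
proof -
  define C where "C k = A - k \<cdot>\<^sub>m 1\<^sub>m n" for k
  have C: "C k \<in> carrier_mat n n" for k
    unfolding C_def by (intro minus_carrier_mat smult_carrier_mat one_carrier_mat)
  have symA: "A $$ (j, i) = A $$ (i, j)" if "i < n" "j < n" for i j
    using A that by (metis carrier_matD index_transpose_mat(1))
  have symC: "transpose_mat (C k) = C k" for k
    by (rule eq_matI) (use A(1) symA in \<open>auto simp: C_def\<close>)
  have Cv: "C k *\<^sub>v v = A *\<^sub>v v - k \<cdot>\<^sub>v v" if "v \<in> carrier_vec n" for k v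
    using A(1) that by (auto simp: C_def minus_mult_distrib_mat_vec[of _ n n] intro!: eq_vecI)
  have commv: "C k *\<^sub>v (C l *\<^sub>v v) = C l *\<^sub>v (C k *\<^sub>v v)" if v: "v \<in> carrier_vec n" for k l v
  proof -
    \<comment> \<open>The expanded form is symmetric in \<open>k\<close> and
      \<open>l\<close>.\<close>
    have "C k *\<^sub>v (C l *\<^sub>v v) = A *\<^sub>v (A *\<^sub>v v) - k \<cdot>\<^sub>v (A *\<^sub>v v) - l \<cdot>\<^sub>v (A *\<^sub>v v - k \<cdot>\<^sub>v v)" for k l
      using A(1) v C by (simp add: Cv mult_minus_distrib_mat_vec[of _ n n] mult_mat_vec[of _ n n])
    then show ?thesis
      using A(1) v by (intro eq_vecI) (auto simp: algebra_simps)
  qed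
  obtain es where es: "char_poly A = (\<Prod>e\<leftarrow>es. [:- e, 1:])"
    using char_poly_real_symmetric_splits[OF A] by blast
  obtain B P Q where BPQ: "schur_decomposition A es = (B, P, Q)" by (metis prod_cases3)
  have wit: "similar_mat_wit A B P Q" and ut: "upper_triangular B" and diag: "diag_mat B = es"
    using schur_decomposition[OF A(1) es BPQ] by auto
  have carr: "B \<in> carrier_mat n n" "P \<in> carrier_mat n n" "Q \<in> carrier_mat n n"
    and PQ: "P * Q = 1\<^sub>m n" "Q * P = 1\<^sub>m n" and APBQ: "A = P * B * Q"
    using similar_mat_witD2[OF A(1) wit] by auto
  have diag_ev: "eigenvalue A (B $$ (i, i))" if "i < n" for i
  proof -
    have "B $$ (i, i) \<in> set es" using that carr diag[symmetric] by (auto simp: diag_mat_def)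
    then show ?thesis
      using linear_poly_root by (simp add: eigenvalue_root_char_poly[OF A(1)] es)
  qed
  have CP: "C k *\<^sub>v (P *\<^sub>v v) = P *\<^sub>v (B *\<^sub>v v - k \<cdot>\<^sub>v v)" if v: "v \<in> carrier_vec n" for k v
  proof -
    have "A * P = P * B"
      using carr PQ APBQ by (smt (verit) assoc_mult_mat mult_carrier_mat right_mult_one_mat)
    then have "A *\<^sub>v (P *\<^sub>v v) = P *\<^sub>v (B *\<^sub>v v)"
      using A carr v by (metis assoc_mult_mat_vec)
    then show ?thesis
      using carr v by (simp add: Cv mult_minus_distrib_mat_vec[of _ n n] mult_mat_vec[of _ n n])
  qed
  have kill: "C a *\<^sub>v (C b *\<^sub>v (P *\<^sub>v v)) = 0\<^sub>v n"
    if "m \<le> n" "v \<in> carrier_vec n" "\<And>i. m \<le> i \<Longrightarrow> i < n \<Longrightarrow> v $ i = 0" for m v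
    using that
  proof (induction m arbitrary: v)
    case 0
    then have "v = 0\<^sub>v n" by (intro eq_vecI) auto
    moreover have "M *\<^sub>v 0\<^sub>v n = 0\<^sub>v n" if "M \<in> carrier_mat n n" for M :: "real mat"
      using that by (intro eq_vecI) auto
    ultimately show ?case using carr C by simp
  next
    case (Suc m)
    define k where "k = B $$ (m, m)"
    define u where "u = B *\<^sub>v v - k \<cdot>\<^sub>v v"
    have u: "u \<in> carrier_vec n" using carr Suc.prems by (simp add: u_def)
    have Pv: "P *\<^sub>v v \<in> carrier_vec n" using carr Suc.prems by simp
    \<comment> \<open>In row \<open>i \<ge> m\<close>, triangularity removes the columns
      \<open>j < i\<close> and the support of \<open>v\<close> removes \<open>j > i\<close>. The
      remaining diagonal term is cancelled by \<open>k\<close> if \<open>i = m\<close>, and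
      \<open>v $ i\<close> is zero if \<open>i > m\<close>.\<close>
    have "u $ i = 0" if i: "m \<le> i" "i < n" for i
    proof -
      have "(B *\<^sub>v v) $ i = (\<Sum>j<n. B $$ (i, j) * v $ j)"
        using carr i Suc.prems by (auto simp: scalar_prod_def atLeast0LessThan)
      also have "\<dots> = (\<Sum>j<n. if j = i then B $$ (i, i) * v $ i else 0)"
      proof (rule sum.cong)
        fix j assume "j \<in> {..<n}"
        then show "B $$ (i, j) * v $ j = (if j = i then B $$ (i, i) * v $ i else 0)"
          using i Suc.prems(3)[of j] upper_triangularD[OF ut, of j i] carr
          by (cases j i rule: linorder_cases) auto
      qed simp
      also have "\<dots> = B $$ (i, i) * v $ i" using i by simp
      finally show ?thesis
        using i Suc.prems carr by (cases "i = m") (auto simp: u_def k_def)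
    qed
    then have "C a *\<^sub>v (C b *\<^sub>v (P *\<^sub>v u)) = 0\<^sub>v n"
      using Suc.IH u Suc.prems(1) by simp
    then have 0: "C a *\<^sub>v (C b *\<^sub>v (C k *\<^sub>v (P *\<^sub>v v))) = 0\<^sub>v n"
      using CP Suc.prems(2) by (simp add: u_def)
    have "k = a \<or> k = b" using ev diag_ev Suc.prems(1) by (simp add: k_def)
    then show ?case
    proof
      assume "k = a"
      then have "C a *\<^sub>v (C a *\<^sub>v (C b *\<^sub>v (P *\<^sub>v v))) = 0\<^sub>v n"
        using 0 commv[OF Pv] by simp
      then show ?thesis
        using symmetric_mat_ker_square[OF C symC mult_mat_vec_carrier[OF C Pv]] by blast
    next
      assume "k = b"
      then have "C b *\<^sub>v (C b *\<^sub>v (C a *\<^sub>v (P *\<^sub>v v))) = 0\<^sub>v n"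
        using 0 commv C Pv by (metis mult_mat_vec_carrier)
      then have "C b *\<^sub>v (C a *\<^sub>v (P *\<^sub>v v)) = 0\<^sub>v n"
        using symmetric_mat_ker_square[OF C symC mult_mat_vec_carrier[OF C Pv]] by blast
      then show ?thesis using commv[OF Pv] by simp
    qed
  qed
  have "C a *\<^sub>v (C b *\<^sub>v v) = 0\<^sub>v n" if v: "v \<in> carrier_vec n" for v
  proof -
    \<comment> \<open>Every vector lies in the range of \<open>P\<close>, and for
      \<open>m = n\<close> the support condition is vacuous.\<close>
    have "v = P *\<^sub>v (Q *\<^sub>v v)" using v carr PQ by (metis assoc_mult_mat_vec one_mult_mat_vec)
    then show ?thesis using kill[of n "Q *\<^sub>v v"] carr v by simp
  qed
  then have z: "(C a * C b) *\<^sub>v v = 0\<^sub>v n" if "v \<in> carrier_vec n" for v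
    using that C by (metis assoc_mult_mat_vec)
  have "(C a * C b) $$ (i, j) = 0" if "i < n" "j < n" for i j
  proof -
    have "M $$ (i, j) = (M *\<^sub>v unit_vec n j) $ i" if "M \<in> carrier_mat n n" for M :: "real mat"
      using that \<open>i < n\<close> \<open>j < n\<close> by simp
    from this[OF mult_carrier_mat[OF C C]] show ?thesis
      using that by (simp only: z unit_vec_carrier index_zero_vec)
  qed
  then have "C a * C b = 0\<^sub>m n n" using C[of a] C[of b] by (intro eq_matI) auto
  then show ?thesis by (simp add: C_def)
qed

section \<open>Lower bound from a unique common neighbour\<close>

lemma common_neighbour_q_matrix_ge_3:
  fixes A :: "real mat"
  assumes A: "A \<in> carrier_mat n n" "transpose_mat A = A"
    and xyc: "x < n" "y < n" "c < n" "x \<noteq> y" "c \<noteq> x" "c \<noteq> y"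
    and xy: "A $$ (x, y) = 0" and xc: "A $$ (x, c) \<noteq> 0" and cy: "A $$ (c, y) \<noteq> 0"
    and unique: "\<And>k. k < n \<Longrightarrow> k \<noteq> x \<Longrightarrow> k \<noteq> y \<Longrightarrow> k \<noteq> c \<Longrightarrow> A $$ (x, k) * A $$ (k, y) = 0"
  shows "q_matrix A \<ge> 3"
proof (rule ccontr)
  assume "\<not> ?thesis"
  then have card: "card {k. eigenvalue A k} \<le> 2" by (simp add: q_matrix_def)
  have fin: "finite {k. eigenvalue A k}"
    using card_finite_spectrum(1)[OF A(1)] by (simp add: spectrum_def)
  \<comment> \<open>Inclusion rather than equality covers smaller spectra as well: \<open>a\<close>
    and \<open>b\<close> may coincide.\<close>
  have "\<exists>a b. {k. eigenvalue A k} \<subseteq> {a, b}"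
  proof -
    consider "card {k. eigenvalue A k} = 0" | "card {k. eigenvalue A k} = 1"
      | "card {k. eigenvalue A k} = 2" using card by linarith
    then show ?thesis
      using fin by cases (auto simp: card_1_singleton_iff card_2_iff)
  qed
  then obtain a b where "\<And>k. eigenvalue A k \<Longrightarrow> k = a \<or> k = b" by blast
  from symmetric_mat_two_eigenvalues[OF A this]
  have "0 = ((A - a \<cdot>\<^sub>m 1\<^sub>m n) * (A - b \<cdot>\<^sub>m 1\<^sub>m n)) $$ (x, y)" using xyc by simp
  also have "\<dots> = (\<Sum>k<n. (A $$ (x, k) - (if x = k then a else 0)) *
      (A $$ (k, y) - (if k = y then b else 0)))"
    using A xyc by (auto simp: scalar_prod_def atLeast0LessThan intro!: sum.cong)
  \<comment> \<open>The diagonal shifts enter only at \<open>k = x\<close> and \<open>k = y\<close>,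
    and there the other factor is the zero entry \<open>A $$ (x, y)\<close>.\<close>
  also have "\<dots> = (\<Sum>k<n. if k = c then A $$ (x, c) * A $$ (c, y) else 0)"
    using xyc xy unique by (intro sum.cong) auto
  also have "\<dots> = A $$ (x, c) * A $$ (c, y)" using xyc by simp
  finally show False using xc cy by simp
qed

section \<open>Upper bound: spectrum of a sum of rank-one matrices\<close>

text \<open>For an eigenvector \<open>v\<close>, the vector \<open>z\<close> of its inner products
  with the \<open>w i\<close> satisfies \<open>(I + J) z = k z\<close>, and for
  \<open>k \<noteq> 0\<close> it determines \<open>v\<close>. The value 0 allows for vectors
  orthogonal to all \<open>w i\<close>.\<close>

lemma Gram_one_plus_all_ones_eigenvalues:
  fixes w :: "nat \<Rightarrow> nat \<Rightarrow> real"
  assumes gram: "\<And>i j. i < s \<Longrightarrow> j < s \<Longrightarrow> (\<Sum>x<n. w i x * w j x) = (if i = j then 2 else 1)"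
    and k: "eigenvalue (mat n n (\<lambda>(x, y). \<Sum>i<s. w i x * w i y)) k"
  shows "k \<in> {0, 1, 1 + real s}"
proof (rule ccontr)
  assume nk: "k \<notin> {0, 1, 1 + real s}"
  obtain v where v: "v \<in> carrier_vec n" "v \<noteq> 0\<^sub>v n"
    and Av: "mat n n (\<lambda>(x, y). \<Sum>i<s. w i x * w i y) *\<^sub>v v = k \<cdot>\<^sub>v v"
    using k unfolding eigenvalue_def eigenvector_def by auto
  define z where "z i = (\<Sum>x<n. w i x * v $ x)" for i
  have kv: "k * v $ x = (\<Sum>i<s. z i * w i x)" if "x < n" for x
  proof -
    have "k * v $ x = (mat n n (\<lambda>(x, y). \<Sum>i<s. w i x * w i y) *\<^sub>v v) $ x"
      using v that by (simp add: Av)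
    also have "\<dots> = (\<Sum>y<n. \<Sum>i<s. w i x * w i y * v $ y)"
      using v that by (simp add: scalar_prod_def atLeast0LessThan sum_distrib_right)
    also have "\<dots> = (\<Sum>i<s. z i * w i x)"
      unfolding z_def by (subst sum.swap) (simp add: sum_distrib_right sum_distrib_left mult_ac)
    finally show ?thesis .
  qed
  have kz: "k * z j = z j + (\<Sum>i<s. z i)" if "j < s" for j
  proof -
    have "k * z j = (\<Sum>x<n. w j x * (k * v $ x))"
      by (simp add: z_def sum_distrib_left mult_ac)
    also have "\<dots> = (\<Sum>x<n. \<Sum>i<s. z i * (w i x * w j x))"
      by (simp add: kv sum_distrib_left mult_ac)
    also have "\<dots> = (\<Sum>i<s. z i * (\<Sum>x<n. w i x * w j x))"
      by (subst sum.swap) (simp add: sum_distrib_left)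
    also have "\<dots> = (\<Sum>i<s. z i + (if i = j then z j else 0))"
      using that by (intro sum.cong) (auto simp: gram)
    also have "\<dots> = z j + (\<Sum>i<s. z i)"
      using that by (simp add: sum.distrib)
    finally show ?thesis .
  qed
  \<comment> \<open>Summing over \<open>j\<close> isolates the all-ones direction, with eigenvalue
    \<open>1 + s\<close>. Excluding \<open>1 + s\<close>, 1 and 0 in turn forces the sum of
    \<open>z\<close>, then \<open>z\<close>, then \<open>v\<close> to vanish.\<close>
  have "k * (\<Sum>i<s. z i) = (\<Sum>j<s. z j + (\<Sum>i<s. z i))"
    by (simp add: sum_distrib_left kz)
  also have "\<dots> = (1 + real s) * (\<Sum>i<s. z i)" by (simp add: sum.distrib algebra_simps)
  finally have "(\<Sum>i<s. z i) = 0" using nk by simp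
  then have "z j = 0" if "j < s" for j using kz[OF that] nk by simp
  then have "v $ x = 0" if "x < n" for x using kv[OF that] nk by simp
  then have "v = 0\<^sub>v n" using v(1) by (intro eq_vecI) auto
  then show False using v(2) by simp
qed

section \<open>Both bounds for the clique-star\<close>

theorem theorem4p4:
  fixes ns :: "nat list" and n :: nat and G :: "nat pair_pre_digraph"
  assumes "length ns \<ge> 2"
    and "\<forall>k \<in> set ns. k \<ge> 2"
    and "pverts G = {0..<n}"
    and "is_clique_star ns G"
  shows "q_graph G = 3"
proof -
  define s where "s = length ns"
  obtain c H where H: "\<forall>i < s. complete_digraph (ns ! i) (with_proj (H i)) \<and> c \<in> pverts (H i)"
    and Hdisj: "\<forall>i < s. \<forall>j < s. i \<noteq> j \<longrightarrow> pverts (H i) \<inter> pverts (H j) = {c}"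
    and HV: "pverts G = (\<Union>i < s. pverts (H i))"
    and HE: "parcs G = (\<Union>i < s. parcs (H i))"
    using assms(4) unfolding is_clique_star_def s_def by (elim exE conjE)
  \<comment> \<open>The non-central vertices of each clique: pairwise disjoint sets, nonempty
    because \<open>ns ! i \<ge> 2\<close>.\<close>
  define V where "V i = pverts (H i) - {c}" for i
  have s2: "s \<ge> 2" using assms(1) by (simp add: s_def)
  have pv: "pverts (H i) = insert c (V i)" if "i < s" for i
    using H that by (auto simp: V_def)
  have cV: "c \<notin> V i" for i by (simp add: V_def)
  have finV: "finite (V i)" and cardV: "card (V i) \<ge> 1"
    and arcs: "parcs (H i) = {(u, v). u \<in> insert c (V i) \<and> v \<in> insert c (V i) \<and> u \<noteq> v}"
    if i: "i < s" for i
  proof -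
    have *: "finite (pverts (H i))" "card (pverts (H i)) = ns ! i"
      "parcs (H i) = {(u, v). (u, v) \<in> pverts (H i) \<times> pverts (H i) \<and> u \<noteq> v}"
      using H i unfolding complete_digraph_pair_def by auto
    show fin: "finite (V i)" using * by (simp add: V_def)
    have "ns ! i \<ge> 2" using assms(2) i by (simp add: s_def)
    then show "card (V i) \<ge> 1" using * fin cV by (simp add: pv[OF i])
    show "parcs (H i) = {(u, v). u \<in> insert c (V i) \<and> v \<in> insert c (V i) \<and> u \<noteq> v}"
      using * pv[OF i] by auto
  qed
  have disj: "i = j" if "x \<in> V i" "x \<in> V j" "i < s" "j < s" for i j x
    using Hdisj[rule_format, of i j] that by (auto simp: V_def)
  have vert: "x < n \<longleftrightarrow> x = c \<or> (\<exists>i<s. x \<in> V i)" for x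
  proof -
    have "x < n \<longleftrightarrow> x \<in> pverts G" using assms(3) by simp
    also have "\<dots> \<longleftrightarrow> (\<exists>i<s. x = c \<or> x \<in> V i)" using pv by (auto simp: HV)
    moreover have "0 < s" using s2 by simp
    ultimately show ?thesis by blast
  qed
  have E: "(x, y) \<in> parcs G \<longleftrightarrow> x \<noteq> y \<and> (\<exists>i<s. x \<in> insert c (V i) \<and> y \<in> insert c (V i))" for x y
    by (auto simp: HE arcs)
  have cn: "c < n" using vert by blast
  have card: "card (pverts G) = n" using assms(3) by simp
  have lower: "q_matrix A \<ge> 3" if "A \<in> sym_matrices G" for A
  proof -
    have A: "A \<in> carrier_mat n n" "transpose_mat A = A"
      and AE: "\<And>i j. i < n \<Longrightarrow> j < n \<Longrightarrow> i \<noteq> j \<Longrightarrow> A $$ (i, j) \<noteq> 0 \<longleftrightarrow> (i, j) \<in> parcs G"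
      using that by (auto simp: sym_matrices_def card)
    have "V 0 \<noteq> {}" "V 1 \<noteq> {}" using cardV[of 0] cardV[of 1] s2 by auto
    then obtain x y where x: "x \<in> V 0" and y: "y \<in> V 1" by blast
    have only: "i = 0" if "x \<in> V i" "i < s" for i using disj[OF that(1) x that(2)] s2 by simp
    have only': "i = 1" if "y \<in> V i" "i < s" for i using disj[OF that(1) y that(2)] s2 by simp
    have ne: "x \<noteq> y" "c \<noteq> x" "c \<noteq> y" using x y only[of 1] s2 cV by auto
    have lt: "x < n" "y < n" using x y s2 by (auto simp: vert intro: exI[of _ "0::nat"] exI[of _ "1::nat"])
    show ?thesis
    proof (rule common_neighbour_q_matrix_ge_3[OF A lt cn ne])
      have "(x, y) \<notin> parcs G" using ne only only' by (auto simp: E)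
      then show "A $$ (x, y) = 0" using AE lt ne by blast
      have "(x, c) \<in> parcs G" using x s2 ne by (auto simp: E intro: exI[of _ "0::nat"])
      then show "A $$ (x, c) \<noteq> 0" using AE lt cn ne by metis
      have "(c, y) \<in> parcs G" using y s2 ne by (auto simp: E intro: exI[of _ "1::nat"])
      then show "A $$ (c, y) \<noteq> 0" using AE lt cn ne by metis
      fix k assume k: "k < n" "k \<noteq> x" "k \<noteq> y" "k \<noteq> c"
      \<comment> \<open>Each of \<open>x\<close> and \<open>y\<close> lies in a single clique, so a
        common neighbour other than \<open>c\<close> would lie in both \<open>V 0\<close> and
        \<open>V 1\<close>.\<close>
      have "\<not> ((x, k) \<in> parcs G \<and> (k, y) \<in> parcs G)"
      proof
        assume "(x, k) \<in> parcs G \<and> (k, y) \<in> parcs G"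
        then have "k \<in> V 0" "k \<in> V 1" using ne k only only' by (auto simp: E)
        then show False using disj[of k 0 1] s2 by simp
      qed
      then show "A $$ (x, k) * A $$ (k, y) = 0" using AE lt k by (metis mult_eq_0_iff)
    qed
  qed
  \<comment> \<open>This scaling makes the non-central part of \<open>w i\<close> a unit vector, so
    that the diagonal Gram entries are \<open>1 + 1\<close>.\<close>
  define t where "t i = 1 / sqrt (card (V i))" for i
  define w where "w i x = (if x = c then 1 else if x \<in> V i then t i else 0)" for i x
  define A where "A = mat n n (\<lambda>(x, y). \<Sum>i<s. w i x * w i y)"
  have t: "t i > 0" "card (V i) * (t i * t i) = 1" if "i < s" for i
    using cardV[OF that] by (auto simp: t_def field_simps)
  have gram: "(\<Sum>x<n. w i x * w j x) = (if i = j then 2 else 1)" if ij: "i < s" "j < s" for i j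
  proof -
    have "(\<Sum>x<n. w i x * w j x) = w i c * w j c + (\<Sum>x\<in>{..<n} - {c}. w i x * w j x)"
      using cn by (intro sum.remove) auto
    \<comment> \<open>For \<open>i \<noteq> j\<close> the non-central supports are disjoint, so only
      the center contributes to the Gram entry.\<close>
    also have "(\<Sum>x\<in>{..<n} - {c}. w i x * w j x) = (\<Sum>x\<in>V i. if i = j then t i * t i else 0)"
      using ij cV disj by (intro sum.mono_neutral_cong_right) (auto simp: w_def vert)
    also have "\<dots> = (if i = j then 1 else 0)" using t[OF ij(2)] by simp
    finally show ?thesis by (simp add: w_def)
  qed
  have "A \<in> sym_matrices G"
    unfolding sym_matrices_def card
  proof (intro CollectI conjI allI impI)
    show "A \<in> carrier_mat n n" by (simp add: A_def)
    show "transpose_mat A = A" by (auto simp: A_def mult.commute)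
    fix x y assume xy: "x < n" "y < n" "x \<noteq> y"
    \<comment> \<open>Nonnegativity rules out cancellation: an entry of \<open>A\<close> vanishes
      exactly when each summand does.\<close>
    have w0: "w i x * w i y \<ge> 0" if "i < s" for i using t(1)[OF that] by (simp add: w_def)
    have wz: "w i z = 0 \<longleftrightarrow> z \<notin> insert c (V i)" if "i < s" for i z
      using t(1)[OF that] by (simp add: w_def)
    have "A $$ (x, y) = 0 \<longleftrightarrow> (\<forall>i<s. w i x * w i y = 0)"
      using xy w0 by (simp add: A_def, subst sum_nonneg_eq_0_iff) auto
    also have "\<dots> \<longleftrightarrow> (\<forall>i<s. \<not> (x \<in> insert c (V i) \<and> y \<in> insert c (V i)))"
      using wz by simp
    finally show "A $$ (x, y) \<noteq> 0 \<longleftrightarrow> (x, y) \<in> parcs G" using xy by (auto simp: E)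
  qed
  moreover have "q_matrix A \<le> 3"
  proof -
    have "{k. eigenvalue A k} \<subseteq> {0, 1, 1 + real s}"
      using Gram_one_plus_all_ones_eigenvalues[OF gram] by (auto simp: A_def)
    then have "q_matrix A \<le> card {0, 1, 1 + real s}"
      unfolding q_matrix_def by (intro card_mono) auto
    also have "\<dots> \<le> 3" by (simp add: card_insert_if)
    finally show ?thesis .
  qed
  \<comment> \<open>The matrix \<open>A\<close> gives \<open>q_graph G \<le> 3\<close>; the lower
    bound is applied to a matrix attaining \<open>q_graph G\<close>.\<close>
  ultimately show ?thesis
    using lower q_graph_attained[OF is_clique_star_pair_graph[OF assms(4)]]
    by (metis order.antisym order.trans)
qed

end
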